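(* For any two Q-systems $P$ and $Q$ in the C*-2-category $\mathcal{G}$ of compact quantum groups, unitary bimodules and intertwiners, the hom category $\mathbf{QSys}(\mathcal{G})(Q,P)$ of the Q-system completion of $\mathcal{G}$ is a full subcategory of the category $\mathbf{QBL}_{Q,P}$ of quantum bi-elements of the pair $(Q,P)$.
   Context: **The C*-2-category $\mathcal{G}$.** A compact quantum group $\mathbb{G}$ is given by a unital C*-algebra $C(\mathbb{G})$ and a unital *-homomorphism $\Delta: C(\mathbb{G})\to C(\mathbb{G})\otimes C(\mathbb{G})$ with $(\Delta\otimes 1)\Delta=(1\otimes\Delta)\Delta$ and such that $(C(\mathbb{G})\otimes 1)\Delta(C(\mathbb{G}))$ and $(1\otimes C(\mathbb{G}))\Delta(C(\mathbb{G}))$ are dense in $C(\mathbb{G})\otimes C(\mathbb{G})$. For a finite dimensional Hilbert space $H$, $H\otimes C(\mathbb{G})$ has the $C(\mathbb{G})$-valued inner product $\langle \xi\otimes x,\eta\otimes y\rangle_{C(\mathbb{G})}=\langle\xi,\eta\rangle x^*y$, and similarly $C(\mathbb{G})\otimes H$. A unitary $\mathbb{G}$-$\mathbb{H}$ bimodule is a finite dimensional Hilbert space $V$ with linear maps $\alpha_{\mathbb{G},V}:V\to C(\mathbb{G})\otimes V$ and $\alpha_{V,\mathbb{H}}:V\to V\otimes C(\mathbb{H})$ such that (i) $(\Delta\otimes 1_V)\alpha_{\mathbb{G},V}=(1\otimes\alpha_{\mathbb{G},V})\alpha_{\mathbb{G},V}$; (ii) $(1_V\otimes\Delta)\alpha_{V,\mathbb{H}}=(\alpha_{V,\mathbb{H}}\otimes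 1)\alpha_{V,\mathbb{H}}$; (iii) $(1\otimes\alpha_{V,\mathbb{H}})\alpha_{\mathbb{G},V}=(\alpha_{\mathbb{G},V}\otimes 1)\alpha_{V,\mathbb{H}}$; (iv) $\langle\alpha_{\mathbb{G},V}(\xi),\alpha_{\mathbb{G},V}(\eta)\rangle_{C(\mathbb{G})}=\langle\xi,\eta\rangle 1$ and $\langle\alpha_{V,\mathbb{H}}(\xi),\alpha_{V,\mathbb{H}}(\eta)\rangle_{C(\mathbb{H})}=\langle\xi,\eta\rangle 1$. A $\mathbb{G}$-$\mathbb{H}$ intertwiner $T:V\to W$ is a linear map with $(1\otimes T)\alpha_{\mathbb{G},V}=\alpha_{\mathbb{G},W}T$ and $(T\otimes 1)\alpha_{V,\mathbb{H}}=\alpha_{W,\mathbb{H}}T$. $\mathcal{G}$ has compact quantum groups as $0$-cells, unitary bimodules as $1$-cells, intertwiners as $2$-cells; the composite of $1$-cells is $V\boxtimes W=V\otimes W$ with co-actions $\alpha_{\mathbb{G},V}\otimes 1_W$ and $1_V\otimes\alpha_{W,\mathbb{K}}$; composition, tensor product and adjoint of $2$-cells are those of linear maps between Hilbert spaces (treated strictly, associators and unitors being identities); unit $1$-cells have underlying space $\mathbb{C}$ with trivial co-actions. **Q-systems.** A Q-system in a C*-2-category $\mathcal{C}$ is a $1$-cell $Q\in\mathcal{C}_1(b,b)$ with $2$-cells $m_Q:Q\boxtimes Q\to Q$, $i_Q:1_b\to Q$ satisfying $m_Q(m_Q\boxtimes 1)=m_Q(1\boxtimes m_Q)$; $m_Q(i_Q\boxtimes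 1)=1_Q=m_Q(1\boxtimes i_Q)$; $(m_Q\boxtimes 1)(1\boxtimes m_Q^* )=m_Q^*m_Q=(1\boxtimes m_Q)(m_Q^*\boxtimes 1)$; $m_Qm_Q^*=1_Q$. A Q-system in $\mathbf{Hilb}$ (finite dimensional Hilbert spaces and linear maps) is the special case of a one-object $2$-category. A Q-system in $\mathcal{G}$ is regarded as a Q-system in $\mathbf{Hilb}$ by forgetting the co-actions. **$\mathbf{QSys}(\mathcal{C})$.** Its $0$-cells are Q-systems in $\mathcal{C}$. For Q-systems $P\in\mathcal{C}_1(a,a)$, $Q\in\mathcal{C}_1(b,b)$, the $1$-cells between them, i.e. the objects of $\mathbf{QSys}(\mathcal{C})(Q,P)$, are $Q$-$P$ bimodules $(X,\lambda_X,\rho_X)$: a $1$-cell $X\in\mathcal{C}_1(b,a)$ with $2$-cells $\lambda=\lambda_X:Q\boxtimes X\to X$ and $\rho=\rho_X:X\boxtimes P\to X$ such that (B1) $\lambda(1_Q\boxtimes\lambda)=\lambda(m_Q\boxtimes 1_X)$, $\rho(\rho\boxtimes 1_P)=\rho(1_X\boxtimes m_P)$, $\lambda(1_Q\boxtimes\rho)=\rho(\lambda\boxtimes 1_P)$; (B2) $\lambda(i_Q\boxtimes 1_X)=1_X=\rho(1_X\boxtimes i_P)$; (B3) $(m_Q\boxtimes 1_X)(1_Q\boxtimes\lambda^* )=\lambda^*\lambda=(1_Q\boxtimes\lambda)(m_Q^*\boxtimes 1_X)$ and $(1_X\boxtimes m_P)(\rho^*\boxtimes 1_P)=\rho^*\rho=(\rho\boxtimes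 1_P)(1_X\boxtimes m_P^* )$; (B4) $\lambda\lambda^*=1_X=\rho\rho^*$. The $2$-cells from $X$ to $Y$ (morphisms of the hom category) are $f\in\mathcal{C}_2(X,Y)$ with $f\lambda_X=\lambda_Y(1_Q\boxtimes f)$ and $f\rho_X=\rho_Y(f\boxtimes 1_P)$. **Quantum bi-elements.** For Q-systems $A,B$ in $\mathbf{Hilb}$, a quantum bi-element of $(A,B)$ is a triple $(H,Q_1,Q_2)$ with $H$ a finite dimensional Hilbert space and $Q_1:H\to A\otimes H$, $Q_2:H\to H\otimes B$ linear such that (1) $(1_A\otimes Q_1)Q_1=(m_A^*\otimes 1_H)Q_1$, $(Q_2\otimes 1_B)Q_2=(1_H\otimes m_B^* )Q_2$, $(1_A\otimes Q_2)Q_1=(Q_1\otimes 1_B)Q_2$; (2) $(i_A^*\otimes 1_H)Q_1=1_H=(1_H\otimes i_B^* )Q_2$; (3) $Q_1^*=(i_A^*m_A\otimes 1_H)(1_A\otimes Q_1)$ and $Q_2^*=(1_H\otimes i_B^*m_B)(Q_2\otimes 1_B)$. An intertwiner $f:(H,Q_1,Q_2)\to(K,P_1,P_2)$ of quantum bi-elements of $(A,B)$ is a linear map $f:H\to K$ with $(1_A\otimes f)Q_1=P_1f$ and $(f\otimes 1_B)Q_2=P_2f$. $\mathbf{QBL}_{A,B}$ is the category with objects the quantum bi-elements of $(A,B)$ and morphisms the intertwiners, composed as linear maps. A $Q$-$P$ bimodule $(X,\lambda_X,\rho_X)$ in $\mathcal{G}$ is regarded as an object of $\mathbf{QBL}_{Q,P}$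 as $(X,\lambda_X^*,\rho_X^* )$ (co-actions on $X$ forgotten), and a bimodule intertwiner as its underlying linear map. *)

theory Defs
  imports
    "HOL-Analysis.Infinite_Sum"
    "HOL-Library.FuncSet"
    "Jordan_Normal_Form.Schur_Decomposition"
begin

section \<open>Bounded operators on Hilbert spaces\<close>

text \<open>
  A bounded operator on the Hilbert space of square-summable families indexed by the type \<open>'i\<close>
  is represented by its matrix in the canonical orthonormal basis; the row index comes first.
\<close>

type_synonym 'i op = "'i \<Rightarrow> 'i \<Rightarrow> complex"

definition op_bound :: "real \<Rightarrow> 'i op \<Rightarrow> bool" where
  "op_bound C M \<longleftrightarrow> 0 \<le> C \<and> (\<forall>F x y. finite F \<longrightarrow>
     cmod (\<Sum>i\<in>F. \<Sum>j\<in>F. cnj (y i) * M i j * x j)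
       \<le> C * sqrt (\<Sum>i\<in>F. (cmod (y i))\<^sup>2) * sqrt (\<Sum>j\<in>F. (cmod (x j))\<^sup>2))"

definition bounded_op :: "'i op \<Rightarrow> bool" where
  "bounded_op M \<longleftrightarrow> (\<exists>C. op_bound C M)"

text \<open>Only meaningful when \<open>bounded_op M\<close> holds.\<close>

definition op_norm :: "'i op \<Rightarrow> real" where
  "op_norm M = Inf {C. op_bound C M}"

definition op_zero :: "'i op" where "op_zero = (\<lambda>i j. 0)"
definition op_one :: "'i op" where "op_one = (\<lambda>i j. if i = j then 1 else 0)"
definition op_add :: "'i op \<Rightarrow> 'i op \<Rightarrow> 'i op" where "op_add M N = (\<lambda>i j. M i j + N i j)"
definition op_diff :: "'i op \<Rightarrow> 'i op \<Rightarrow> 'i op" where "op_diff M N = (\<lambda>i j. M i j - N i j)"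
definition op_scale :: "complex \<Rightarrow> 'i op \<Rightarrow> 'i op" where "op_scale c M = (\<lambda>i j. c * M i j)"
definition op_sum :: "('k \<Rightarrow> 'i op) \<Rightarrow> 'k set \<Rightarrow> 'i op" where
  "op_sum f K = (\<lambda>i j. \<Sum>k\<in>K. f k i j)"
definition op_star :: "'i op \<Rightarrow> 'i op" where "op_star M = (\<lambda>i j. cnj (M j i))"

text \<open>For bounded operators the series defining the entries of a product converges absolutely.\<close>

definition op_mult :: "'i op \<Rightarrow> 'i op \<Rightarrow> 'i op" where
  "op_mult M N = (\<lambda>i j. \<Sum>\<^sub>\<infinity>k. M i k * N k j)"

definition op_tensor :: "'i op \<Rightarrow> 'j op \<Rightarrow> ('i \<times> 'j) op" where
  "op_tensor M N = (\<lambda>(i, j) (k, l). M i k * N j l)"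

definition op_span :: "'i op set \<Rightarrow> 'i op set" where
  "op_span S = {op_sum (\<lambda>M. op_scale (c M) M) T | T c. finite T \<and> T \<subseteq> S}"

definition op_closure :: "'i op set \<Rightarrow> 'i op set" where
  "op_closure S = {M. bounded_op M \<and> (\<forall>e>0. \<exists>N\<in>S. op_norm (op_diff M N) < e)}"

section \<open>C*-algebras and compact quantum groups\<close>

text \<open>
  Unital C*-algebras are concrete: norm-closed unital *-subalgebras of the bounded operators on
  a Hilbert space. By the Gelfand-Naimark theorem every nonzero unital C*-algebra is of this
  form. The tensor product is the minimal (spatial) one, which does not depend on the chosen
  faithful representations.
\<close>

definition cstar_algebra :: "'i op set \<Rightarrow> bool" where
  "cstar_algebra A \<longleftrightarrow>
     (\<forall>M\<in>A. bounded_op M) \<and> op_zero \<in> A \<and> op_one \<in> A \<and>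
     (\<forall>M\<in>A. \<forall>N\<in>A. op_add M N \<in> A \<and> op_mult M N \<in> A) \<and>
     (\<forall>c. \<forall>M\<in>A. op_scale c M \<in> A) \<and>
     (\<forall>M\<in>A. op_star M \<in> A) \<and>
     op_closure A \<subseteq> A"

definition cstar_tensor :: "'i op set \<Rightarrow> 'j op set \<Rightarrow> ('i \<times> 'j) op set" where
  "cstar_tensor A B = op_closure (op_span {op_tensor M N | M N. M \<in> A \<and> N \<in> B})"

definition unital_star_hom :: "'i op set \<Rightarrow> 'j op set \<Rightarrow> ('i op \<Rightarrow> 'j op) \<Rightarrow> bool" where
  "unital_star_hom A B \<Phi> \<longleftrightarrow>
     \<Phi> \<in> A \<rightarrow> B \<and> \<Phi> op_one = op_one \<and>
     (\<forall>M\<in>A. \<forall>N\<in>A. \<Phi> (op_add M N) = op_add (\<Phi> M) (\<Phi> N) \<and>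
        \<Phi> (op_mult M N) = op_mult (\<Phi> M) (\<Phi> N)) \<and>
     (\<forall>c. \<forall>M\<in>A. \<Phi> (op_scale c M) = op_scale c (\<Phi> M)) \<and>
     (\<forall>M\<in>A. \<Phi> (op_star M) = op_star (\<Phi> M))"

text \<open>
  The amplifications \<open>\<Phi> \<otimes> 1\<close> and \<open>1 \<otimes> \<Phi>\<close> of a *-homomorphism \<open>\<Phi>\<close> defined on \<open>A\<close>.
  Regard an element of \<open>A \<otimes> B\<close> as an operator matrix indexed by the second tensor leg; its
  entries, being slices of the element, lie in \<open>A\<close>, and \<open>\<Phi> \<otimes> 1\<close> applies \<open>\<Phi>\<close> to each of them.
  This is continuous and maps \<open>M \<otimes> N\<close> to \<open>\<Phi> M \<otimes> N\<close>. Symmetrically for \<open>1 \<otimes> \<Phi>\<close>.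
\<close>

definition amp_left :: "('i op \<Rightarrow> 'p op) \<Rightarrow> ('i \<times> 'j) op \<Rightarrow> ('p \<times> 'j) op" where
  "amp_left \<Phi> X = (\<lambda>(p, j) (r, l). \<Phi> (\<lambda>i k. X (i, j) (k, l)) p r)"

definition amp_right :: "('j op \<Rightarrow> 'p op) \<Rightarrow> ('i \<times> 'j) op \<Rightarrow> ('i \<times> 'p) op" where
  "amp_right \<Phi> X = (\<lambda>(i, p) (k, r). \<Phi> (\<lambda>j l. X (i, j) (k, l)) p r)"

definition op_assoc :: "(('i \<times> 'j) \<times> 'k) op \<Rightarrow> ('i \<times> ('j \<times> 'k)) op" where
  "op_assoc X = (\<lambda>(i, (j, k)) (i', (j', k')). X ((i, j), k) ((i', j'), k'))"

record 'i cqg =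
  cqg_alg :: "'i op set"
  cqg_comult :: "'i op \<Rightarrow> ('i \<times> 'i) op"

definition compact_quantum_group :: "'i cqg \<Rightarrow> bool" where
  "compact_quantum_group G \<longleftrightarrow>
     (let A = cqg_alg G; \<Delta> = cqg_comult G in
       cstar_algebra A \<and>
       unital_star_hom A (cstar_tensor A A) \<Delta> \<and>
       (\<forall>M\<in>A. op_assoc (amp_left \<Delta> (\<Delta> M)) = amp_right \<Delta> (\<Delta> M)) \<and>
       op_closure (op_span {op_mult (op_tensor M op_one) (\<Delta> N) | M N. M \<in> A \<and> N \<in> A})
         = cstar_tensor A A \<and>
       op_closure (op_span {op_mult (op_tensor op_one M) (\<Delta> N) | M N. M \<in> A \<and> N \<in> A})
         = cstar_tensor A A)"

section \<open>Tensor products of finite dimensional Hilbert spaces\<close>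

text \<open>
  Finite dimensional Hilbert spaces are the standard spaces of complex column vectors of length
  \<open>n\<close> (including \<open>n = 0\<close>), and linear maps are matrices. With the Kronecker product below the
  tensor product is strictly associative and strictly unital. The first argument of
  \<open>kron_with\<close> multiplies entries; it is used both for complex matrices and for matrices of which
  one factor has entries in a C*-algebra.
\<close>

definition kron_with :: "('a \<Rightarrow> 'b \<Rightarrow> 'c) \<Rightarrow> 'a mat \<Rightarrow> 'b mat \<Rightarrow> 'c mat" where
  "kron_with f A B = mat (dim_row A * dim_row B) (dim_col A * dim_col B)
     (\<lambda>(i, j). f (A $$ (i div dim_row B, j div dim_col B)) (B $$ (i mod dim_row B, j mod dim_col B)))"

definition kron :: "complex mat \<Rightarrow> complex mat \<Rightarrow> complex mat" (infixl "\<otimes>\<^sub>m" 75) where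
  "A \<otimes>\<^sub>m B = kron_with (*) A B"

notation mat_adjoint ("_\<^sup>\<dagger>" [1000] 999)

section \<open>Unitary bimodules and intertwiners\<close>

text \<open>
  A linear map \<open>\<alpha>\<close> from an \<open>n\<close>-dimensional \<open>V\<close> to \<open>C \<otimes> W\<close> or to \<open>W \<otimes> C\<close>, for an \<open>m\<close>-dimensional
  \<open>W\<close> and a C*-algebra \<open>C\<close>, is given by the \<open>m \<times> n\<close> matrix over \<open>C\<close> with
  \<open>\<alpha> e\<^sub>j = (\<Sum>i. \<alpha>\<^sub>i\<^sub>j \<otimes> e\<^sub>i)\<close>, respectively \<open>\<alpha> e\<^sub>j = (\<Sum>i. e\<^sub>i \<otimes> \<alpha>\<^sub>i\<^sub>j)\<close>. In composites of two such maps,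
  the Hilbert space index is kept as the matrix index, wherever the space stands among the
  tensor factors, and the algebra legs are listed from left to right.

  \<open>then_right \<alpha> \<beta>\<close> is \<open>(1 \<otimes> \<alpha>) \<beta>\<close> for \<open>\<beta>\<close> with values in \<open>C \<otimes> V\<close>: its \<open>(i, j)\<close> entry is
  \<open>\<Sum>k. \<beta>\<^sub>k\<^sub>j \<otimes> \<alpha>\<^sub>i\<^sub>k\<close>.
  \<open>then_left \<alpha> \<beta>\<close> is \<open>(\<alpha> \<otimes> 1) \<beta>\<close> for \<open>\<beta>\<close> with values in \<open>V \<otimes> C\<close>: its \<open>(i, j)\<close> entry is
  \<open>\<Sum>k. \<alpha>\<^sub>i\<^sub>k \<otimes> \<beta>\<^sub>k\<^sub>j\<close>.
\<close>

definition then_right :: "'j op mat \<Rightarrow> 'i op mat \<Rightarrow> ('i \<times> 'j) op mat" where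
  "then_right \<alpha> \<beta> = mat (dim_row \<alpha>) (dim_col \<beta>)
     (\<lambda>(i, j). op_sum (\<lambda>k. op_tensor (\<beta> $$ (k, j)) (\<alpha> $$ (i, k))) {..<dim_col \<alpha>})"

definition then_left :: "'i op mat \<Rightarrow> 'j op mat \<Rightarrow> ('i \<times> 'j) op mat" where
  "then_left \<alpha> \<beta> = mat (dim_row \<alpha>) (dim_col \<beta>)
     (\<lambda>(i, j). op_sum (\<lambda>k. op_tensor (\<alpha> $$ (i, k)) (\<beta> $$ (k, j))) {..<dim_col \<alpha>})"

text \<open>
  The matrix of algebra-valued inner products \<open>\<langle>\<alpha> e\<^sub>j, \<alpha> e\<^sub>l\<rangle>\<close>, which are conjugate linear in the
  first argument.
\<close>

definition op_gram :: "'i op mat \<Rightarrow> 'i op mat" where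
  "op_gram \<alpha> = mat (dim_col \<alpha>) (dim_col \<alpha>)
     (\<lambda>(j, l). op_sum (\<lambda>i. op_mult (op_star (\<alpha> $$ (i, j))) (\<alpha> $$ (i, l))) {..<dim_row \<alpha>})"

text \<open>\<open>v \<mapsto> 1 \<otimes> v\<close>, respectively \<open>v \<mapsto> v \<otimes> 1\<close>.\<close>

definition trivial_coaction :: "nat \<Rightarrow> 'i op mat" where
  "trivial_coaction n = mat n n (\<lambda>(i, j). if i = j then op_one else op_zero)"

text \<open>\<open>(1 \<otimes> T) \<alpha>\<close> or \<open>(T \<otimes> 1) \<alpha>\<close>, and \<open>\<alpha> T\<close>, for a complex matrix \<open>T\<close>.\<close>

definition post_linear :: "complex mat \<Rightarrow> 'i op mat \<Rightarrow> 'i op mat" where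
  "post_linear T \<alpha> = mat (dim_row T) (dim_col \<alpha>)
     (\<lambda>(i, j). op_sum (\<lambda>k. op_scale (T $$ (i, k)) (\<alpha> $$ (k, j))) {..<dim_col T})"

definition pre_linear :: "'i op mat \<Rightarrow> complex mat \<Rightarrow> 'i op mat" where
  "pre_linear \<alpha> T = mat (dim_row \<alpha>) (dim_col T)
     (\<lambda>(i, j). op_sum (\<lambda>k. op_scale (T $$ (k, j)) (\<alpha> $$ (i, k))) {..<dim_row T})"

record ('i, 'j) one_cell =
  cell_dim :: nat
  left_co :: "'i op mat"
  right_co :: "'j op mat"

definition unitary_bimodule :: "'i cqg \<Rightarrow> 'j cqg \<Rightarrow> ('i, 'j) one_cell \<Rightarrow> bool" where
  "unitary_bimodule G H V \<longleftrightarrow>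
     (let n = cell_dim V; \<alpha> = left_co V; \<beta> = right_co V in
       \<alpha> \<in> carrier_mat n n \<and> elements_mat \<alpha> \<subseteq> cqg_alg G \<and>
       \<beta> \<in> carrier_mat n n \<and> elements_mat \<beta> \<subseteq> cqg_alg H \<and>
       map_mat (cqg_comult G) \<alpha> = then_right \<alpha> \<alpha> \<and>
       map_mat (cqg_comult H) \<beta> = then_left \<beta> \<beta> \<and>
       then_right \<beta> \<alpha> = then_left \<alpha> \<beta> \<and>
       op_gram \<alpha> = trivial_coaction n \<and>
       op_gram \<beta> = trivial_coaction n)"

definition two_cell ::
    "('i, 'j) one_cell \<Rightarrow> ('i, 'j) one_cell \<Rightarrow> complex mat \<Rightarrow> bool" where
  "two_cell V W T \<longleftrightarrow>
     T \<in> carrier_mat (cell_dim W) (cell_dim V) \<and>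
     post_linear T (left_co V) = pre_linear (left_co W) T \<and>
     post_linear T (right_co V) = pre_linear (right_co W) T"

definition comp_cell ::
    "('i, 'j) one_cell \<Rightarrow> ('j, 'k) one_cell \<Rightarrow> ('i, 'k) one_cell" (infixl "\<boxtimes>" 75) where
  "V \<boxtimes> W =
     \<lparr> cell_dim = cell_dim V * cell_dim W,
       left_co = kron_with (\<lambda>M c. op_scale c M) (left_co V) (1\<^sub>m (cell_dim W)),
       right_co = kron_with op_scale (1\<^sub>m (cell_dim V)) (right_co W) \<rparr>"

definition unit_cell :: "('i, 'i) one_cell" where
  "unit_cell = \<lparr> cell_dim = 1, left_co = trivial_coaction 1, right_co = trivial_coaction 1 \<rparr>"

section \<open>Q-systems\<close>

record hilb_qsystem =
  hq_dim :: nat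
  hq_mult :: "complex mat"
  hq_unit :: "complex mat"

definition hilb_qsystem :: "hilb_qsystem \<Rightarrow> bool" where
  "hilb_qsystem A \<longleftrightarrow>
     (let n = hq_dim A; m = hq_mult A; i = hq_unit A; I = 1\<^sub>m n in
       m \<in> carrier_mat n (n * n) \<and> i \<in> carrier_mat n 1 \<and>
       m * (m \<otimes>\<^sub>m I) = m * (I \<otimes>\<^sub>m m) \<and>
       m * (i \<otimes>\<^sub>m I) = I \<and> m * (I \<otimes>\<^sub>m i) = I \<and>
       (m \<otimes>\<^sub>m I) * (I \<otimes>\<^sub>m m\<^sup>\<dagger>) = m\<^sup>\<dagger> * m \<and>
       (I \<otimes>\<^sub>m m) * (m\<^sup>\<dagger> \<otimes>\<^sub>m I) = m\<^sup>\<dagger> * m \<and>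
       m * m\<^sup>\<dagger> = I)"

record 'i qsystem =
  q_cell :: "('i, 'i) one_cell"
  q_mult :: "complex mat"
  q_unit :: "complex mat"

definition forget_coactions :: "'i qsystem \<Rightarrow> hilb_qsystem" where
  "forget_coactions Q = \<lparr> hq_dim = cell_dim (q_cell Q), hq_mult = q_mult Q, hq_unit = q_unit Q \<rparr>"

text \<open>
  Composition, tensor product and adjoint of 2-cells are those of linear maps, so the equations
  of a Q-system are those in the category of Hilbert spaces; in addition the underlying object is
  a unitary bimodule and the structure maps are intertwiners.
\<close>

definition qsystem :: "'i cqg \<Rightarrow> 'i qsystem \<Rightarrow> bool" where
  "qsystem G Q \<longleftrightarrow>
     unitary_bimodule G G (q_cell Q) \<and>
     two_cell (q_cell Q \<boxtimes> q_cell Q) (q_cell Q) (q_mult Q) \<and>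
     two_cell unit_cell (q_cell Q) (q_unit Q) \<and>
     hilb_qsystem (forget_coactions Q)"

section \<open>Categories\<close>

record ('o, 'm) cat =
  Obj :: "'o set"
  Hom :: "'o \<Rightarrow> 'o \<Rightarrow> 'm set"
  Comp :: "'m \<Rightarrow> 'm \<Rightarrow> 'm"
  Ident :: "'o \<Rightarrow> 'm"

definition category :: "('o, 'm) cat \<Rightarrow> bool" where
  "category C \<longleftrightarrow>
     (\<forall>X\<in>Obj C. Ident C X \<in> Hom C X X) \<and>
     (\<forall>X\<in>Obj C. \<forall>Y\<in>Obj C. \<forall>Z\<in>Obj C. \<forall>f\<in>Hom C X Y. \<forall>g\<in>Hom C Y Z. Comp C g f \<in> Hom C X Z) \<and>
     (\<forall>X\<in>Obj C. \<forall>Y\<in>Obj C. \<forall>f\<in>Hom C X Y. Comp C f (Ident C X) = f \<and> Comp C (Ident C Y) f = f) \<and>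
     (\<forall>W\<in>Obj C. \<forall>X\<in>Obj C. \<forall>Y\<in>Obj C. \<forall>Z\<in>Obj C.
        \<forall>f\<in>Hom C W X. \<forall>g\<in>Hom C X Y. \<forall>h\<in>Hom C Y Z.
          Comp C h (Comp C g f) = Comp C (Comp C h g) f)"

text \<open>
  The category \<open>C\<close> is a full subcategory of \<open>D\<close> when its objects are regarded as objects of \<open>D\<close>
  by means of the injective map \<open>F\<close> and its morphisms are regarded as morphisms of \<open>D\<close> as
  they are.
\<close>

definition full_subcategory_via :: "('o \<Rightarrow> 'p) \<Rightarrow> ('o, 'm) cat \<Rightarrow> ('p, 'm) cat \<Rightarrow> bool" where
  "full_subcategory_via F C D \<longleftrightarrow>
     category C \<and> category D \<and>
     F \<in> Obj C \<rightarrow> Obj D \<and> inj_on F (Obj C) \<and>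
     (\<forall>X\<in>Obj C. \<forall>Y\<in>Obj C. Hom C X Y = Hom D (F X) (F Y)) \<and>
     (\<forall>X\<in>Obj C. Ident C X = Ident D (F X)) \<and>
     (\<forall>X\<in>Obj C. \<forall>Y\<in>Obj C. \<forall>Z\<in>Obj C. \<forall>f\<in>Hom C X Y. \<forall>g\<in>Hom C Y Z. Comp C g f = Comp D g f)"

section \<open>The hom categories of the Q-system completion\<close>

record ('i, 'j) bimod =
  bm_cell :: "('i, 'j) one_cell"
  bm_left :: "complex mat"
  bm_right :: "complex mat"

text \<open>\<open>Q\<close>-\<open>P\<close> bimodules, for Q-systems \<open>Q\<close> over \<open>H\<close> and \<open>P\<close> over \<open>G\<close>.\<close>

definition bimodule ::
    "'i cqg \<Rightarrow> 'j cqg \<Rightarrow> 'i qsystem \<Rightarrow> 'j qsystem \<Rightarrow> ('i, 'j) bimod \<Rightarrow> bool" where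
  "bimodule H G Q P B \<longleftrightarrow>
     (let X = bm_cell B; lm = bm_left B; rm = bm_right B;
          mQ = q_mult Q; iQ = q_unit Q; mP = q_mult P; iP = q_unit P;
          IQ = 1\<^sub>m (cell_dim (q_cell Q)); IP = 1\<^sub>m (cell_dim (q_cell P)); IX = 1\<^sub>m (cell_dim X) in
       unitary_bimodule H G X \<and>
       two_cell (q_cell Q \<boxtimes> X) X lm \<and> two_cell (X \<boxtimes> q_cell P) X rm \<and>
       lm * (IQ \<otimes>\<^sub>m lm) = lm * (mQ \<otimes>\<^sub>m IX) \<and>
       rm * (rm \<otimes>\<^sub>m IP) = rm * (IX \<otimes>\<^sub>m mP) \<and>
       lm * (IQ \<otimes>\<^sub>m rm) = rm * (lm \<otimes>\<^sub>m IP) \<and>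
       lm * (iQ \<otimes>\<^sub>m IX) = IX \<and> rm * (IX \<otimes>\<^sub>m iP) = IX \<and>
       (mQ \<otimes>\<^sub>m IX) * (IQ \<otimes>\<^sub>m lm\<^sup>\<dagger>) = lm\<^sup>\<dagger> * lm \<and>
       (IQ \<otimes>\<^sub>m lm) * (mQ\<^sup>\<dagger> \<otimes>\<^sub>m IX) = lm\<^sup>\<dagger> * lm \<and>
       (IX \<otimes>\<^sub>m mP) * (rm\<^sup>\<dagger> \<otimes>\<^sub>m IP) = rm\<^sup>\<dagger> * rm \<and>
       (rm \<otimes>\<^sub>m IP) * (IX \<otimes>\<^sub>m mP\<^sup>\<dagger>) = rm\<^sup>\<dagger> * rm \<and>
       lm * lm\<^sup>\<dagger> = IX \<and> rm * rm\<^sup>\<dagger> = IX)"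

definition bimodule_intertwiner ::
    "'i qsystem \<Rightarrow> 'j qsystem \<Rightarrow> ('i, 'j) bimod \<Rightarrow> ('i, 'j) bimod \<Rightarrow> complex mat \<Rightarrow> bool" where
  "bimodule_intertwiner Q P B B' f \<longleftrightarrow>
     two_cell (bm_cell B) (bm_cell B') f \<and>
     f * bm_left B = bm_left B' * (1\<^sub>m (cell_dim (q_cell Q)) \<otimes>\<^sub>m f) \<and>
     f * bm_right B = bm_right B' * (f \<otimes>\<^sub>m 1\<^sub>m (cell_dim (q_cell P)))"

definition QSys_hom ::
    "'i cqg \<Rightarrow> 'j cqg \<Rightarrow> 'i qsystem \<Rightarrow> 'j qsystem \<Rightarrow> (('i, 'j) bimod, complex mat) cat" where
  "QSys_hom H G Q P =
     \<lparr> Obj = {B. bimodule H G Q P B},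
       Hom = (\<lambda>B B'. {f. bimodule_intertwiner Q P B B' f}),
       Comp = (*),
       Ident = (\<lambda>B. 1\<^sub>m (cell_dim (bm_cell B))) \<rparr>"

section \<open>Quantum bi-elements\<close>

record bielement =
  be_dim :: nat
  be_left :: "complex mat"
  be_right :: "complex mat"

definition quantum_bielement :: "hilb_qsystem \<Rightarrow> hilb_qsystem \<Rightarrow> bielement \<Rightarrow> bool" where
  "quantum_bielement A B E \<longleftrightarrow>
     (let n = be_dim E; Q1 = be_left E; Q2 = be_right E;
          mA = hq_mult A; iA = hq_unit A; mB = hq_mult B; iB = hq_unit B;
          IA = 1\<^sub>m (hq_dim A); IB = 1\<^sub>m (hq_dim B); IH = 1\<^sub>m n in
       Q1 \<in> carrier_mat (hq_dim A * n) n \<and> Q2 \<in> carrier_mat (n * hq_dim B) n \<and>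
       (IA \<otimes>\<^sub>m Q1) * Q1 = (mA\<^sup>\<dagger> \<otimes>\<^sub>m IH) * Q1 \<and>
       (Q2 \<otimes>\<^sub>m IB) * Q2 = (IH \<otimes>\<^sub>m mB\<^sup>\<dagger>) * Q2 \<and>
       (IA \<otimes>\<^sub>m Q2) * Q1 = (Q1 \<otimes>\<^sub>m IB) * Q2 \<and>
       (iA\<^sup>\<dagger> \<otimes>\<^sub>m IH) * Q1 = IH \<and> (IH \<otimes>\<^sub>m iB\<^sup>\<dagger>) * Q2 = IH \<and>
       Q1\<^sup>\<dagger> = ((iA\<^sup>\<dagger> * mA) \<otimes>\<^sub>m IH) * (IA \<otimes>\<^sub>m Q1) \<and>
       Q2\<^sup>\<dagger> = (IH \<otimes>\<^sub>m (iB\<^sup>\<dagger> * mB)) * (Q2 \<otimes>\<^sub>m IB))"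

definition bielement_intertwiner ::
    "hilb_qsystem \<Rightarrow> hilb_qsystem \<Rightarrow> bielement \<Rightarrow> bielement \<Rightarrow> complex mat \<Rightarrow> bool" where
  "bielement_intertwiner A B E E' f \<longleftrightarrow>
     f \<in> carrier_mat (be_dim E') (be_dim E) \<and>
     (1\<^sub>m (hq_dim A) \<otimes>\<^sub>m f) * be_left E = be_left E' * f \<and>
     (f \<otimes>\<^sub>m 1\<^sub>m (hq_dim B)) * be_right E = be_right E' * f"

definition QBL :: "hilb_qsystem \<Rightarrow> hilb_qsystem \<Rightarrow> (bielement, complex mat) cat" where
  "QBL A B =
     \<lparr> Obj = {E. quantum_bielement A B E},
       Hom = (\<lambda>E E'. {f. bielement_intertwiner A B E E' f}),
       Comp = (*),
       Ident = (\<lambda>E. 1\<^sub>m (be_dim E)) \<rparr>"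

definition bielement_of :: "('i, 'j) bimod \<Rightarrow> bielement" where
  "bielement_of B =
     \<lparr> be_dim = cell_dim (bm_cell B), be_left = (bm_left B)\<^sup>\<dagger>, be_right = (bm_right B)\<^sup>\<dagger> \<rparr>"

end

theory Submission
  imports Defs
begin

text \<open>
  By the Frobenius and unit axioms an action and its adjoint determine each other:
  \<open>\<lambda> = (i\<^sup>*m \<otimes> 1) (1 \<otimes> \<lambda>\<^sup>*)\<close>. Hence adjoints of actions are quantum bi-elements, and a linear map
  commutes with actions if and only if it commutes with their adjoints. Equivariance of \<open>\<lambda>\<close> says
  \<open>(1 \<otimes> \<lambda>) (\<alpha>\<^sub>Q \<otimes> 1) = \<alpha>\<^sub>X \<lambda>\<close>; since \<open>\<lambda>\<close> is a coisometry, \<open>\<alpha>\<^sub>X\<close> is determined by \<open>\<alpha>\<^sub>Q\<close> and \<open>\<lambda>\<close>, so the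
  forgetful map is injective on objects. For the same reason every linear map commuting with the
  actions is automatically equivariant, which gives fullness.
\<close>

section \<open>Matrices\<close>

lemma mat_mult_assoc:
  fixes A B C :: "'a::semiring_0 mat"
  assumes "dim_col A = dim_row B" and "dim_col B = dim_row C"
  shows "A * B * C = A * (B * C)"
  by (rule assoc_mult_mat) (use assms in \<open>auto intro: carrier_matI\<close>)

lemma dim_mat_adjoint [simp]:
  "dim_row (A\<^sup>\<dagger>) = dim_col A" "dim_col (A\<^sup>\<dagger>) = dim_row A"
  by (simp_all add: mat_adjoint_def)

lemma index_mat_adjoint [simp]:
  "i < dim_col A \<Longrightarrow> j < dim_row A \<Longrightarrow> A\<^sup>\<dagger> $$ (i, j) = conjugate (A $$ (j, i))"
  by (simp add: mat_adjoint_def mat_of_rows_index)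

lemma mat_adjoint_adjoint [simp]: "(A\<^sup>\<dagger>)\<^sup>\<dagger> = A"
  by (intro eq_matI) auto

lemma mat_adjoint_one [simp]: "(1\<^sub>m n :: complex mat)\<^sup>\<dagger> = 1\<^sub>m n"
  by (intro eq_matI) auto

lemma mat_adjoint_mult:
  fixes A B :: "complex mat"
  assumes "dim_col A = dim_row B"
  shows "(A * B)\<^sup>\<dagger> = B\<^sup>\<dagger> * A\<^sup>\<dagger>"
  using assms by (intro eq_matI) (auto simp: scalar_prod_def mult.commute)

lemma mat_adjoint_inject [simp]: "A\<^sup>\<dagger> = B\<^sup>\<dagger> \<longleftrightarrow> A = B"
  by (metis mat_adjoint_adjoint)

section \<open>Kronecker products\<close>

lemma dim_kron_with [simp]:
  "dim_row (kron_with f A B) = dim_row A * dim_row B"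
  "dim_col (kron_with f A B) = dim_col A * dim_col B"
  by (simp_all add: kron_with_def)

lemma dim_kron [simp]:
  "dim_row (A \<otimes>\<^sub>m B) = dim_row A * dim_row B" "dim_col (A \<otimes>\<^sub>m B) = dim_col A * dim_col B"
  by (simp_all add: kron_def)

lemma div_less_of_less_mult: "i < a * b \<Longrightarrow> i div b < (a::nat)"
  by (simp add: less_mult_imp_div_less)

lemma mod_less_of_less_mult: "i < a * b \<Longrightarrow> i mod b < (b::nat)"
  by (cases "b = 0") simp_all

lemma index_kron:
  "i < dim_row A * dim_row B \<Longrightarrow> j < dim_col A * dim_col B \<Longrightarrow>
    (A \<otimes>\<^sub>m B) $$ (i, j) =
      A $$ (i div dim_row B, j div dim_col B) * B $$ (i mod dim_row B, j mod dim_col B)"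
  by (simp add: kron_def kron_with_def)

text \<open>An index of a product space is a two-digit number: quotient and remainder are the
  positions in the two legs. The bounds on these digits are what entrywise rewriting with
  \<open>index_kron\<close> asks for.\<close>

lemma eq_mat_div_modI:
  assumes "dim_row M = a * b" "dim_row N = a * b" "dim_col M = c * d" "dim_col N = c * d"
    and "\<And>i j. i < a * b \<Longrightarrow> j < c * d \<Longrightarrow> i div b < a \<Longrightarrow> i mod b < b \<Longrightarrow>
      j div d < c \<Longrightarrow> j mod d < d \<Longrightarrow> M $$ (i, j) = N $$ (i, j)"
  shows "M = N"
proof (rule eq_matI)
  fix i j
  assume "i < dim_row N" and "j < dim_col N"
  then have "i < a * b" and "j < c * d"
    using assms by simp_all
  then show "M $$ (i, j) = N $$ (i, j)"
    using div_less_of_less_mult mod_less_of_less_mult by (intro assms(5)) blast+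
qed (use assms in simp_all)

text \<open>The range of length \<open>a * b\<close> falls into \<open>a\<close> consecutive blocks
  of length \<open>b\<close>, block \<open>p\<close> consisting of the indices
  \<open>p * b + q\<close>. This turns a sum over a tensor product basis into a double sum.\<close>

lemma sum_div_mod:
  fixes g :: "nat \<Rightarrow> nat \<Rightarrow> 'a::comm_monoid_add"
  shows "(\<Sum>k<a * b. g (k div b) (k mod b)) = (\<Sum>p<a. \<Sum>q<b. g p q)"
proof -
  have "(\<Sum>k<a * b. g (k div b) (k mod b)) =
      (\<Sum>p<a. \<Sum>k\<in>{p * b..<p * b + b}. g (k div b) (k mod b))"
    by (rule sum.nat_group[symmetric])
  also have "\<dots> = (\<Sum>p<a. \<Sum>q<b. g p q)"
  proof (rule sum.cong[OF refl])
    fix p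
    have "(\<Sum>k\<in>{p * b..<p * b + b}. g (k div b) (k mod b)) =
        (\<Sum>q\<in>{0..<b}. g ((q + p * b) div b) ((q + p * b) mod b))"
      using sum.shift_bounds_nat_ivl[of "\<lambda>k. g (k div b) (k mod b)" 0 "p * b" b]
      by (simp add: add.commute)
    also have "\<dots> = (\<Sum>q<b. g p q)"
      by (intro sum.cong) auto
    finally show "(\<Sum>k\<in>{p * b..<p * b + b}. g (k div b) (k mod b)) = (\<Sum>q<b. g p q)" .
  qed
  finally show ?thesis .
qed

text \<open>The interchange law, on which every sliding of maps past each other in different legs
  rests. By \<open>sum_div_mod\<close> the sum over the middle index becomes a double sum, which
  factors.\<close>

lemma kron_mult:
  assumes "dim_col A = dim_row C" and "dim_col B = dim_row D"
  shows "(A \<otimes>\<^sub>m B) * (C \<otimes>\<^sub>m D) = (A * C) \<otimes>\<^sub>m (B * D)"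
proof (rule eq_mat_div_modI[of _ "dim_row A" "dim_row B" _ "dim_col C" "dim_col D"])
  fix i j
  assume ij: "i < dim_row A * dim_row B" "j < dim_col C * dim_col D"
    "i div dim_row B < dim_row A" "i mod dim_row B < dim_row B"
    "j div dim_col D < dim_col C" "j mod dim_col D < dim_col D"
  let ?i1 = "i div dim_row B" and ?i2 = "i mod dim_row B"
    and ?j1 = "j div dim_col D" and ?j2 = "j mod dim_col D"
  let ?c = "dim_row C" and ?d = "dim_row D"
  have "((A \<otimes>\<^sub>m B) * (C \<otimes>\<^sub>m D)) $$ (i, j) =
      (\<Sum>k<?c * ?d. (A \<otimes>\<^sub>m B) $$ (i, k) * (C \<otimes>\<^sub>m D) $$ (k, j))"
    using ij assms by (simp add: scalar_prod_def atLeast0LessThan)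
  also have "\<dots> = (\<Sum>k<?c * ?d. A $$ (?i1, k div ?d) * B $$ (?i2, k mod ?d) *
      (C $$ (k div ?d, ?j1) * D $$ (k mod ?d, ?j2)))"
    using ij assms by (intro sum.cong refl) (simp add: index_kron)
  also have "\<dots> = (\<Sum>p<?c. \<Sum>q<?d. A $$ (?i1, p) * B $$ (?i2, q) *
      (C $$ (p, ?j1) * D $$ (q, ?j2)))"
    by (rule sum_div_mod)
  also have "\<dots> = (\<Sum>p<?c. A $$ (?i1, p) * C $$ (p, ?j1)) *
      (\<Sum>q<?d. B $$ (?i2, q) * D $$ (q, ?j2))"
    by (simp add: sum_product algebra_simps)
  also have "\<dots> = ((A * C) \<otimes>\<^sub>m (B * D)) $$ (i, j)"
    using ij assms by (simp add: index_kron scalar_prod_def atLeast0LessThan)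
  finally show "((A \<otimes>\<^sub>m B) * (C \<otimes>\<^sub>m D)) $$ (i, j) = ((A * C) \<otimes>\<^sub>m (B * D)) $$ (i, j)" .
qed simp_all

lemma kron_one_one: "1\<^sub>m a \<otimes>\<^sub>m 1\<^sub>m b = 1\<^sub>m (a * b)"
proof (rule eq_mat_div_modI[of _ a b _ a b])
  fix i j
  assume "i < a * b" "j < a * b" "i div b < a" "i mod b < b" "j div b < a" "j mod b < b"
  moreover have "i = j \<longleftrightarrow> i div b = j div b \<and> i mod b = j mod b"
    by (metis div_mult_mod_eq)
  ultimately show "(1\<^sub>m a \<otimes>\<^sub>m 1\<^sub>m b) $$ (i, j) = 1\<^sub>m (a * b) $$ (i, j)"
    by (simp add: index_kron)
qed simp_all

lemma kron_one_left [simp]: "1\<^sub>m (Suc 0) \<otimes>\<^sub>m A = A"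
  by (intro eq_matI) (auto simp: index_kron)

lemma kron_one_right [simp]: "A \<otimes>\<^sub>m 1\<^sub>m (Suc 0) = A"
  by (intro eq_matI) (auto simp: index_kron)

lemma kron_assoc: "(A \<otimes>\<^sub>m B) \<otimes>\<^sub>m C = A \<otimes>\<^sub>m (B \<otimes>\<^sub>m C)"
proof (intro eq_matI)
  fix i j
  assume "i < dim_row (A \<otimes>\<^sub>m (B \<otimes>\<^sub>m C))" and "j < dim_col (A \<otimes>\<^sub>m (B \<otimes>\<^sub>m C))"
  then have i: "i < dim_row A * dim_row B * dim_row C"
    and j: "j < dim_col A * dim_col B * dim_col C"
    by (simp_all add: mult.assoc)
  \<comment> \<open>An index of a triple product has three digits in mixed radix; these identities
    say that both bracketings read off the same three.\<close>
  have mod_mod: "k mod (b * c) mod c = k mod c" for k b c :: nat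
    by (simp add: mod_mod_cancel)
  have mod_div: "k mod (b * c) div c = k div c mod b" for k b c :: nat
    by (cases "c = 0") (simp_all add: mod_mult2_eq mult.commute[of b])
  have div_div: "k div (b * c) = k div c div b" for k b c :: nat
    by (simp add: div_mult2_eq mult.commute[of b])
  note less = div_less_of_less_mult mod_less_of_less_mult
  have i': "i < dim_row A * (dim_row B * dim_row C)" and j': "j < dim_col A * (dim_col B * dim_col C)"
    using i j by (simp_all add: mult.assoc)
  show "((A \<otimes>\<^sub>m B) \<otimes>\<^sub>m C) $$ (i, j) = (A \<otimes>\<^sub>m (B \<otimes>\<^sub>m C)) $$ (i, j)"
    using i j i' j' less[OF i] less[OF j] less[OF i'] less[OF j']
    by (simp add: index_kron mod_mod mod_div div_div)
qed (simp_all add: mult.assoc)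

lemma mat_adjoint_kron: "(A \<otimes>\<^sub>m B)\<^sup>\<dagger> = A\<^sup>\<dagger> \<otimes>\<^sub>m B\<^sup>\<dagger>"
  by (rule eq_mat_div_modI[of _ "dim_col A" "dim_col B" _ "dim_row A" "dim_row B"])
    (simp_all add: index_kron)

section \<open>Modules over a Q-system\<close>

text \<open>
  Right modules are left modules for the reversed Kronecker product, so the product is kept
  abstract to treat both sides at once.
\<close>

locale tensor_product =
  fixes tens :: "complex mat \<Rightarrow> complex mat \<Rightarrow> complex mat"  (infixl "\<odot>" 75)
  assumes dim_row_tens [simp]: "dim_row (A \<odot> B) = dim_row A * dim_row B"
    and dim_col_tens [simp]: "dim_col (A \<odot> B) = dim_col A * dim_col B"
    and tens_mult: "dim_col A = dim_row C \<Longrightarrow> dim_col B = dim_row D \<Longrightarrow>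
      (A \<odot> B) * (C \<odot> D) = (A * C) \<odot> (B * D)"
    and tens_one_one: "1\<^sub>m a \<odot> 1\<^sub>m b = 1\<^sub>m (a * b)"
    and tens_one_left [simp]: "1\<^sub>m (Suc 0) \<odot> A = A"
    and tens_assoc: "(A \<odot> B) \<odot> C = A \<odot> (B \<odot> C)"
    and adjoint_tens: "(A \<odot> B)\<^sup>\<dagger> = A\<^sup>\<dagger> \<odot> B\<^sup>\<dagger>"

lemma tensor_product_kron: "tensor_product (\<otimes>\<^sub>m)"
  by unfold_locales (simp_all add: kron_mult kron_one_one kron_assoc mat_adjoint_kron)

lemma tensor_product_kron_rev: "tensor_product (\<lambda>A B. B \<otimes>\<^sub>m A)"
  by unfold_locales (simp_all add: kron_mult kron_one_one kron_assoc mat_adjoint_kron mult.commute)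

text \<open>One side of a bimodule. For the reversed product, \<open>act_frobenius\<close> is the
  law \<open>(1 \<otimes> m) (r\<^sup>\<dagger> \<otimes> 1) = r\<^sup>\<dagger> r\<close> of a
  right action \<open>r\<close>.\<close>

locale qsystem_module = tensor_product +
  fixes n :: nat and m i :: "complex mat" and x :: nat and l :: "complex mat"
  assumes mult_carrier: "m \<in> carrier_mat n (n * n)"
    and unit_carrier: "i \<in> carrier_mat n 1"
    and act_carrier: "l \<in> carrier_mat x (n * x)"
    and act_assoc: "l * (1\<^sub>m n \<odot> l) = l * (m \<odot> 1\<^sub>m x)"
    and act_unit: "l * (i \<odot> 1\<^sub>m x) = 1\<^sub>m x"
    and act_frobenius: "(m \<odot> 1\<^sub>m x) * (1\<^sub>m n \<odot> l\<^sup>\<dagger>) = l\<^sup>\<dagger> * l"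
    and act_coisometry: "l * l\<^sup>\<dagger> = 1\<^sub>m x"
begin

lemma dims [simp]:
  "dim_row m = n" "dim_col m = n * n" "dim_row i = n" "dim_col i = Suc 0"
  "dim_row l = x" "dim_col l = n * x"
  using mult_carrier unit_carrier act_carrier by auto

lemma coact_assoc: "(1\<^sub>m n \<odot> l\<^sup>\<dagger>) * l\<^sup>\<dagger> = (m\<^sup>\<dagger> \<odot> 1\<^sub>m x) * l\<^sup>\<dagger>"
  using arg_cong[OF act_assoc, of mat_adjoint] by (simp add: mat_adjoint_mult adjoint_tens)

lemma coact_unit: "(i\<^sup>\<dagger> \<odot> 1\<^sub>m x) * l\<^sup>\<dagger> = 1\<^sub>m x"
  using arg_cong[OF act_unit, of mat_adjoint] by (simp add: mat_adjoint_mult adjoint_tens)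

text \<open>Apply \<open>i\<^sup>\<dagger> \<odot> 1\<close> to the Frobenius law and cancel by
  \<open>coact_unit\<close>. Here \<open>i\<^sup>\<dagger> * m\<close> is the pairing that makes the
  Q-system self-dual, so an action is its adjoint with the algebra leg bent round.\<close>

lemma act_eq: "l = ((i\<^sup>\<dagger> * m) \<odot> 1\<^sub>m x) * (1\<^sub>m n \<odot> l\<^sup>\<dagger>)"
proof -
  have "((i\<^sup>\<dagger> * m) \<odot> 1\<^sub>m x) * (1\<^sub>m n \<odot> l\<^sup>\<dagger>) = (i\<^sup>\<dagger> \<odot> 1\<^sub>m x) * ((m \<odot> 1\<^sub>m x) * (1\<^sub>m n \<odot> l\<^sup>\<dagger>))"
    by (simp add: mat_mult_assoc[symmetric] tens_mult)
  also have "\<dots> = (i\<^sup>\<dagger> \<odot> 1\<^sub>m x) * l\<^sup>\<dagger> * l"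
    by (simp add: act_frobenius mat_mult_assoc)
  finally show ?thesis
    by (simp add: coact_unit)
qed

lemma coact_eq: "l\<^sup>\<dagger> = (1\<^sub>m n \<odot> l) * ((m\<^sup>\<dagger> * i) \<odot> 1\<^sub>m x)"
  using arg_cong[OF act_eq, of mat_adjoint] by (simp add: mat_adjoint_mult adjoint_tens)

text \<open>A coisometry is right invertible, so an operator on the module compatible with a given
  \<open>a\<close> on the algebra is forced. In the application, \<open>a\<close> and
  \<open>b\<close> are coefficients of coactions.\<close>

lemma equivariant_eq:
  assumes "b \<in> carrier_mat x x" and "l * (a \<odot> 1\<^sub>m x) = b * l" and "a \<in> carrier_mat n n"
  shows "b = l * (a \<odot> 1\<^sub>m x) * l\<^sup>\<dagger>"
  using assms by (simp add: mat_mult_assoc act_coisometry)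

end

text \<open>Taking adjoints of one equation would only give a statement about
  \<open>f\<^sup>\<dagger>\<close>. Instead, \<open>coact_eq\<close> and \<open>act_eq\<close>
  express each structure map through the other, with the duality pairing in the algebra legs, past
  which \<open>f\<close> slides.\<close>

lemma module_map_iff_comodule_map:
  assumes "qsystem_module tens n m i x l" and "qsystem_module tens n m i y k"
    and f: "f \<in> carrier_mat y x"
  shows "f * l = k * tens (1\<^sub>m n) f \<longleftrightarrow> tens (1\<^sub>m n) f * l\<^sup>\<dagger> = k\<^sup>\<dagger> * f"
proof -
  interpret X: qsystem_module tens n m i x l by fact
  interpret Y: qsystem_module tens n m i y k by fact
  note [simp] = carrier_matD[OF f]
  let ?e = "i\<^sup>\<dagger> * m"
  have one_tens: "tens (1\<^sub>m (n * n)) A = tens (1\<^sub>m n) (tens (1\<^sub>m n) A)" for A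
    by (metis X.tens_assoc X.tens_one_one)
  show ?thesis
  proof
    assume hom: "f * l = k * tens (1\<^sub>m n) f"
    have "tens (1\<^sub>m n) f * l\<^sup>\<dagger> = tens (1\<^sub>m n) (f * l) * tens (?e\<^sup>\<dagger>) (1\<^sub>m x)"
      by (subst X.coact_eq) (simp add: mat_mult_assoc[symmetric] X.tens_mult mat_adjoint_mult)
    also have "\<dots> = tens (1\<^sub>m n) k * (tens (1\<^sub>m (n * n)) f * tens (?e\<^sup>\<dagger>) (1\<^sub>m x))"
      by (simp add: hom mat_mult_assoc[symmetric] one_tens X.tens_mult)
    \<comment> \<open>The copairing and \<open>f\<close> act in different legs. The copairing starts
      from the one-dimensional space, whence the factor \<open>1\<^sub>m (Suc 0)\<close>, which the
      strict unit law absorbs.\<close>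
    also have "tens (1\<^sub>m (n * n)) f * tens (?e\<^sup>\<dagger>) (1\<^sub>m x) = tens (?e\<^sup>\<dagger>) (1\<^sub>m y) * tens (1\<^sub>m (Suc 0)) f"
      by (subst (1 2) X.tens_mult) simp_all
    also have "tens (1\<^sub>m n) k * \<dots> = k\<^sup>\<dagger> * f"
      by (simp add: mat_mult_assoc[symmetric] mat_adjoint_mult Y.coact_eq[symmetric])
    finally show "tens (1\<^sub>m n) f * l\<^sup>\<dagger> = k\<^sup>\<dagger> * f" .
  next
    assume hom: "tens (1\<^sub>m n) f * l\<^sup>\<dagger> = k\<^sup>\<dagger> * f"
    have "f * l = tens (1\<^sub>m (Suc 0)) f * tens ?e (1\<^sub>m x) * tens (1\<^sub>m n) (l\<^sup>\<dagger>)"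
      by (subst X.act_eq) (simp add: mat_mult_assoc)
    also have "tens (1\<^sub>m (Suc 0)) f * tens ?e (1\<^sub>m x) = tens ?e (1\<^sub>m y) * tens (1\<^sub>m (n * n)) f"
      by (subst (1 2) X.tens_mult) simp_all
    also have "\<dots> * tens (1\<^sub>m n) (l\<^sup>\<dagger>) = tens ?e (1\<^sub>m y) * tens (1\<^sub>m n) (k\<^sup>\<dagger> * f)"
      by (simp add: mat_mult_assoc one_tens X.tens_mult hom)
    also have "\<dots> = tens ?e (1\<^sub>m y) * tens (1\<^sub>m n) (k\<^sup>\<dagger>) * tens (1\<^sub>m n) f"
      by (simp add: mat_mult_assoc X.tens_mult)
    also have "\<dots> = k * tens (1\<^sub>m n) f"
      by (simp add: Y.act_eq[symmetric])
    finally show "f * l = k * tens (1\<^sub>m n) f" .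
  qed
qed

text \<open>Both \<open>f * b * l\<close> and \<open>c * f * l\<close> equal \<open>k\<close> after
  \<open>a\<close> in the algebra leg and \<open>f\<close> in the module leg, and the coisometry
  \<open>l\<close> can be cancelled on the right. With coefficients of coactions for
  \<open>a\<close>, \<open>b\<close>, \<open>c\<close>, module maps become equivariant.\<close>

lemma module_map_equivariant:
  assumes "qsystem_module tens n m i x l" and "qsystem_module tens n m i y k"
    and f: "f \<in> carrier_mat y x" and hom: "f * l = k * tens (1\<^sub>m n) f"
    and a: "a \<in> carrier_mat n n"
    and b: "b \<in> carrier_mat x x" "l * tens a (1\<^sub>m x) = b * l"
    and c: "c \<in> carrier_mat y y" "k * tens a (1\<^sub>m y) = c * k"
  shows "f * b = c * f"
proof -
  interpret X: qsystem_module tens n m i x l by fact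
  interpret Y: qsystem_module tens n m i y k by fact
  note [simp] = carrier_matD[OF f] carrier_matD[OF a] carrier_matD[OF b(1)] carrier_matD[OF c(1)]
  have "f * b * l = f * l * tens a (1\<^sub>m x)"
    by (simp add: mat_mult_assoc b(2))
  also have "\<dots> = k * (tens a (1\<^sub>m y) * tens (1\<^sub>m n) f)"
    by (simp add: hom mat_mult_assoc X.tens_mult)
  also have "\<dots> = c * k * tens (1\<^sub>m n) f"
    by (simp add: c(2)[symmetric] mat_mult_assoc)
  also have "\<dots> = c * f * l"
    by (simp add: mat_mult_assoc hom)
  finally have "f * b * l * l\<^sup>\<dagger> = c * f * l * l\<^sup>\<dagger>"
    by simp
  then show ?thesis
    by (simp add: mat_mult_assoc X.act_coisometry)
qed

section \<open>Coactions as families of complex matrices\<close>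

text \<open>Algebra elements are operators given by their matrices, so a coaction is a family of
  complex matrices indexed by pairs of basis vectors. Equivariance is linear in the coactions and
  involves no product of algebra elements, so it can be tested on each coefficient.\<close>

definition coeff :: "'i \<Rightarrow> 'i \<Rightarrow> 'i op mat \<Rightarrow> complex mat" where
  "coeff a b \<alpha> = map_mat (\<lambda>M. M a b) \<alpha>"

lemma dim_coeff [simp]:
  "dim_row (coeff a b \<alpha>) = dim_row \<alpha>" "dim_col (coeff a b \<alpha>) = dim_col \<alpha>"
  by (simp_all add: coeff_def)

lemma coeff_carrier [simp]: "coeff a b \<alpha> \<in> carrier_mat r s \<longleftrightarrow> \<alpha> \<in> carrier_mat r s"
  unfolding carrier_mat_def by simp

lemma op_mat_eq_iff:
  assumes "dim_row \<alpha> = dim_row \<beta>" and "dim_col \<alpha> = dim_col \<beta>"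
  shows "\<alpha> = \<beta> \<longleftrightarrow> (\<forall>a b. coeff a b \<alpha> = coeff a b \<beta>)"
proof
  assume eq: "\<forall>a b. coeff a b \<alpha> = coeff a b \<beta>"
  show "\<alpha> = \<beta>"
  proof (intro eq_matI ext)
    fix i j a b
    assume "i < dim_row \<beta>" "j < dim_col \<beta>"
    moreover have "coeff a b \<alpha> $$ (i, j) = coeff a b \<beta> $$ (i, j)"
      using eq by simp
    ultimately show "(\<alpha> $$ (i, j)) a b = (\<beta> $$ (i, j)) a b"
      using assms by (simp add: coeff_def)
  qed (use assms in auto)
qed simp

lemma coeff_post_linear:
  "dim_col T = dim_row \<alpha> \<Longrightarrow> coeff a b (post_linear T \<alpha>) = T * coeff a b \<alpha>"
  by (intro eq_matI)
    (simp_all add: coeff_def post_linear_def op_sum_def op_scale_def scalar_prod_def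
      atLeast0LessThan)

lemma coeff_pre_linear:
  "dim_col \<alpha> = dim_row T \<Longrightarrow> coeff a b (pre_linear \<alpha> T) = coeff a b \<alpha> * T"
  by (intro eq_matI)
    (simp_all add: coeff_def pre_linear_def op_sum_def op_scale_def scalar_prod_def
      atLeast0LessThan mult.commute)

lemma post_linear_eq_pre_linear_iff:
  assumes "\<alpha> \<in> carrier_mat x x" and "\<beta> \<in> carrier_mat y y" and "T \<in> carrier_mat y x"
  shows "post_linear T \<alpha> = pre_linear \<beta> T \<longleftrightarrow> (\<forall>a b. T * coeff a b \<alpha> = coeff a b \<beta> * T)"
proof -
  have "dim_row (post_linear T \<alpha>) = dim_row (pre_linear \<beta> T)"
    "dim_col (post_linear T \<alpha>) = dim_col (pre_linear \<beta> T)"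
    using assms by (simp_all add: post_linear_def pre_linear_def)
  then have "post_linear T \<alpha> = pre_linear \<beta> T \<longleftrightarrow>
      (\<forall>a b. coeff a b (post_linear T \<alpha>) = coeff a b (pre_linear \<beta> T))"
    by (rule op_mat_eq_iff)
  moreover have "dim_col T = dim_row \<alpha>" "dim_col \<beta> = dim_row T"
    using assms by simp_all
  ultimately show ?thesis
    by (simp only: coeff_post_linear coeff_pre_linear)
qed

lemma coeff_kron_left:
  "coeff a b (kron_with (\<lambda>M c. op_scale c M) \<alpha> T) = coeff a b \<alpha> \<otimes>\<^sub>m T"
  by (rule eq_mat_div_modI[of _ "dim_row \<alpha>" "dim_row T" _ "dim_col \<alpha>" "dim_col T"])
    (simp_all add: coeff_def kron_with_def index_kron op_scale_def)

lemma coeff_kron_right: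
  "coeff a b (kron_with op_scale T \<alpha>) = T \<otimes>\<^sub>m coeff a b \<alpha>"
  by (rule eq_mat_div_modI[of _ "dim_row T" "dim_row \<alpha>" _ "dim_col T" "dim_col \<alpha>"])
    (simp_all add: coeff_def kron_with_def index_kron op_scale_def)

section \<open>Equivariance of 2-cells and actions in terms of coefficients\<close>

lemma unitary_bimodule_carrier:
  assumes "unitary_bimodule G H V"
  shows "left_co V \<in> carrier_mat (cell_dim V) (cell_dim V)"
    and "right_co V \<in> carrier_mat (cell_dim V) (cell_dim V)"
  using assms by (simp_all add: unitary_bimodule_def Let_def)

lemma two_cell_iff:
  assumes "unitary_bimodule G H V" and "unitary_bimodule G H W"
  shows "two_cell V W T \<longleftrightarrow> T \<in> carrier_mat (cell_dim W) (cell_dim V) \<and>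
    (\<forall>a b. T * coeff a b (left_co V) = coeff a b (left_co W) * T) \<and>
    (\<forall>a b. T * coeff a b (right_co V) = coeff a b (right_co W) * T)"
proof -
  note V = unitary_bimodule_carrier[OF assms(1)] and W = unitary_bimodule_carrier[OF assms(2)]
  show ?thesis
    unfolding two_cell_def
    using post_linear_eq_pre_linear_iff[OF V(1) W(1), of T]
      post_linear_eq_pre_linear_iff[OF V(2) W(2), of T]
    by blast
qed

text \<open>The left coaction on \<open>V \<boxtimes> X\<close> lives on \<open>V\<close> alone. The
  left half of the 2-cell condition thus has the form that \<open>equivariant_eq\<close> and
  \<open>module_map_equivariant\<close> take as hypothesis.\<close>

lemma left_action_equivariant:
  assumes "unitary_bimodule H H V" and "unitary_bimodule H G X" and "two_cell (V \<boxtimes> X) X l"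
  shows "l * (coeff a b (left_co V) \<otimes>\<^sub>m 1\<^sub>m (cell_dim X)) = coeff a b (left_co X) * l"
proof -
  have co: "left_co (V \<boxtimes> X) \<in> carrier_mat (cell_dim (V \<boxtimes> X)) (cell_dim (V \<boxtimes> X))"
    using unitary_bimodule_carrier[OF assms(1)]
    by (intro carrier_matI) (simp_all add: comp_cell_def)
  have "l * coeff a b (left_co (V \<boxtimes> X)) = coeff a b (left_co X) * l"
    using post_linear_eq_pre_linear_iff[OF co unitary_bimodule_carrier(1)[OF assms(2)], of l] assms(3)
    by (simp add: two_cell_def)
  then show ?thesis
    by (simp add: comp_cell_def coeff_kron_left)
qed

text \<open>The mirror image: the right coaction on \<open>X \<boxtimes> V\<close> lives on
  \<open>V\<close>, which gives the same form for the reversed product.\<close>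

lemma right_action_equivariant:
  assumes "unitary_bimodule G G V" and "unitary_bimodule H G X" and "two_cell (X \<boxtimes> V) X r"
  shows "r * (1\<^sub>m (cell_dim X) \<otimes>\<^sub>m coeff a b (right_co V)) = coeff a b (right_co X) * r"
proof -
  have co: "right_co (X \<boxtimes> V) \<in> carrier_mat (cell_dim (X \<boxtimes> V)) (cell_dim (X \<boxtimes> V))"
    using unitary_bimodule_carrier[OF assms(1)]
    by (intro carrier_matI) (simp_all add: comp_cell_def)
  have "r * coeff a b (right_co (X \<boxtimes> V)) = coeff a b (right_co X) * r"
    using post_linear_eq_pre_linear_iff[OF co unitary_bimodule_carrier(2)[OF assms(2)], of r] assms(3)
    by (simp add: two_cell_def)
  then show ?thesis
    by (simp add: comp_cell_def coeff_kron_right)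
qed

section \<open>Bimodules and quantum bi-elements\<close>

lemma category_QBL: "category (QBL A B)"
proof -
  have comp: "bielement_intertwiner A B X Z (g * f)"
    if X: "quantum_bielement A B X" and Y: "quantum_bielement A B Y"
      and Z: "quantum_bielement A B Z"
      and f: "bielement_intertwiner A B X Y f" and g: "bielement_intertwiner A B Y Z g"
    for X Y Z f g
  proof -
    have dims [simp]:
      "dim_row f = be_dim Y" "dim_col f = be_dim X" "dim_row g = be_dim Z" "dim_col g = be_dim Y"
      using f g by (auto simp: bielement_intertwiner_def)
    have [simp]: "dim_row (be_left W) = hq_dim A * be_dim W" "dim_col (be_left W) = be_dim W"
      "dim_row (be_right W) = be_dim W * hq_dim B" "dim_col (be_right W) = be_dim W"
      if "quantum_bielement A B W" for W
      using that by (auto simp: quantum_bielement_def Let_def)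
    note [simp] = X Y Z
    have "(1\<^sub>m (hq_dim A) \<otimes>\<^sub>m (g * f)) * be_left X =
        (1\<^sub>m (hq_dim A) \<otimes>\<^sub>m g) * ((1\<^sub>m (hq_dim A) \<otimes>\<^sub>m f) * be_left X)"
      by (simp add: mat_mult_assoc[symmetric] kron_mult)
    also have "\<dots> = (1\<^sub>m (hq_dim A) \<otimes>\<^sub>m g) * be_left Y * f"
      using f by (simp add: bielement_intertwiner_def mat_mult_assoc)
    also have "\<dots> = be_left Z * (g * f)"
      using g by (simp add: bielement_intertwiner_def mat_mult_assoc)
    finally have left: "(1\<^sub>m (hq_dim A) \<otimes>\<^sub>m (g * f)) * be_left X = be_left Z * (g * f)" .
    have "((g * f) \<otimes>\<^sub>m 1\<^sub>m (hq_dim B)) * be_right X =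
        (g \<otimes>\<^sub>m 1\<^sub>m (hq_dim B)) * ((f \<otimes>\<^sub>m 1\<^sub>m (hq_dim B)) * be_right X)"
      by (simp add: mat_mult_assoc[symmetric] kron_mult)
    also have "\<dots> = (g \<otimes>\<^sub>m 1\<^sub>m (hq_dim B)) * be_right Y * f"
      using f by (simp add: bielement_intertwiner_def mat_mult_assoc)
    also have "\<dots> = be_right Z * (g * f)"
      using g by (simp add: bielement_intertwiner_def mat_mult_assoc)
    finally have right: "((g * f) \<otimes>\<^sub>m 1\<^sub>m (hq_dim B)) * be_right X = be_right Z * (g * f)" .
    show ?thesis
      using left right by (auto simp: bielement_intertwiner_def)
  qed
  have ident: "bielement_intertwiner A B X X (1\<^sub>m (be_dim X))" if "quantum_bielement A B X" for X
    using that
    by (auto simp: bielement_intertwiner_def quantum_bielement_def Let_def kron_one_one)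
  show ?thesis
    unfolding category_def QBL_def using comp ident
    by (auto simp: bielement_intertwiner_def)
qed

text \<open>When morphisms, identities and composition agree with those of \<open>D\<close>, the
  category laws of \<open>C\<close> are inherited. So composites of bimodule intertwiners need no
  separate computation.\<close>

lemma full_subcategory_viaI:
  assumes D: "category D" and F: "F \<in> Obj C \<rightarrow> Obj D" and "inj_on F (Obj C)"
    and hom: "\<And>X Y. X \<in> Obj C \<Longrightarrow> Y \<in> Obj C \<Longrightarrow> Hom C X Y = Hom D (F X) (F Y)"
    and ident: "\<And>X. X \<in> Obj C \<Longrightarrow> Ident C X = Ident D (F X)"
    and comp: "Comp C = Comp D"
  shows "full_subcategory_via F C D"
proof -
  have Obj: "F X \<in> Obj D" if "X \<in> Obj C" for X
    using F that by blast
  have id: "Ident D X \<in> Hom D X X" if "X \<in> Obj D" for X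
    using D that by (simp add: category_def)
  have closed: "Comp D g f \<in> Hom D X Z"
    if "X \<in> Obj D" "Y \<in> Obj D" "Z \<in> Obj D" "f \<in> Hom D X Y" "g \<in> Hom D Y Z" for X Y Z f g
    using D that unfolding category_def by blast
  have unit: "Comp D f (Ident D X) = f" "Comp D (Ident D Y) f = f"
    if "X \<in> Obj D" "Y \<in> Obj D" "f \<in> Hom D X Y" for X Y f
    using D that by (auto simp: category_def)
  have assoc: "Comp D h (Comp D g f) = Comp D (Comp D h g) f"
    if "W \<in> Obj D" "X \<in> Obj D" "Y \<in> Obj D" "Z \<in> Obj D"
      "f \<in> Hom D W X" "g \<in> Hom D X Y" "h \<in> Hom D Y Z" for W X Y Z f g h
    using D[unfolded category_def] that by meson
  have "category C"
    unfolding category_def comp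
    by (intro conjI ballI)
      (auto simp: hom ident Obj intro: id closed[OF Obj Obj Obj] unit[OF Obj Obj]
        assoc[OF Obj Obj Obj Obj])
  then show ?thesis
    using assms by (simp add: full_subcategory_via_def)
qed

section \<open>From bimodules to bi-elements\<close>

lemma left_module:
  assumes Q: "qsystem H Q" and B: "bimodule H G Q P B"
  shows "qsystem_module (\<otimes>\<^sub>m) (cell_dim (q_cell Q)) (q_mult Q) (q_unit Q)
    (cell_dim (bm_cell B)) (bm_left B)"
proof (intro qsystem_module.intro tensor_product_kron qsystem_module_axioms.intro)
  show "q_mult Q \<in> carrier_mat (cell_dim (q_cell Q)) (cell_dim (q_cell Q) * cell_dim (q_cell Q))"
    and "q_unit Q \<in> carrier_mat (cell_dim (q_cell Q)) 1"
    using Q by (simp_all add: qsystem_def two_cell_def comp_cell_def unit_cell_def)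
  show "bm_left B \<in> carrier_mat (cell_dim (bm_cell B)) (cell_dim (q_cell Q) * cell_dim (bm_cell B))"
    using B by (simp add: bimodule_def Let_def two_cell_def comp_cell_def)
qed (use B in \<open>simp_all only: bimodule_def Let_def\<close>)

text \<open>Read through the reversed product, the axioms of the right action are literally those of
  the locale; only the dimension of the source has its factors exchanged.\<close>

lemma right_module:
  assumes P: "qsystem G P" and B: "bimodule H G Q P B"
  shows "qsystem_module (\<lambda>A B. B \<otimes>\<^sub>m A) (cell_dim (q_cell P)) (q_mult P) (q_unit P)
    (cell_dim (bm_cell B)) (bm_right B)"
proof (intro qsystem_module.intro tensor_product_kron_rev qsystem_module_axioms.intro)
  show "q_mult P \<in> carrier_mat (cell_dim (q_cell P)) (cell_dim (q_cell P) * cell_dim (q_cell P))"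
    and "q_unit P \<in> carrier_mat (cell_dim (q_cell P)) 1"
    using P by (simp_all add: qsystem_def two_cell_def comp_cell_def unit_cell_def)
  show "bm_right B \<in> carrier_mat (cell_dim (bm_cell B)) (cell_dim (q_cell P) * cell_dim (bm_cell B))"
    using B by (simp add: bimodule_def Let_def two_cell_def comp_cell_def mult.commute)
qed (use B in \<open>simp_all only: bimodule_def Let_def\<close>)

lemma bielement_of_bimodule:
  assumes Q: "qsystem H Q" and P: "qsystem G P" and B: "bimodule H G Q P B"
  shows "quantum_bielement (forget_coactions Q) (forget_coactions P) (bielement_of B)"
proof -
  interpret L: qsystem_module "(\<otimes>\<^sub>m)" "cell_dim (q_cell Q)" "q_mult Q" "q_unit Q"
    "cell_dim (bm_cell B)" "bm_left B"
    by (rule left_module[OF Q B])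
  interpret R: qsystem_module "\<lambda>A B. B \<otimes>\<^sub>m A" "cell_dim (q_cell P)" "q_mult P" "q_unit P"
    "cell_dim (bm_cell B)" "bm_right B"
    by (rule right_module[OF P B])
  have "bm_left B * (1\<^sub>m (cell_dim (q_cell Q)) \<otimes>\<^sub>m bm_right B) =
      bm_right B * (bm_left B \<otimes>\<^sub>m 1\<^sub>m (cell_dim (q_cell P)))"
    using B by (simp add: bimodule_def Let_def)
  then have "(1\<^sub>m (cell_dim (q_cell Q)) \<otimes>\<^sub>m (bm_right B)\<^sup>\<dagger>) * (bm_left B)\<^sup>\<dagger> =
      ((bm_left B)\<^sup>\<dagger> \<otimes>\<^sub>m 1\<^sub>m (cell_dim (q_cell P))) * (bm_right B)\<^sup>\<dagger>"
    by (drule_tac arg_cong[of _ _ mat_adjoint])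
      (simp add: mat_adjoint_mult mat_adjoint_kron mult.commute)
  then show ?thesis
    using L.coact_assoc R.coact_assoc L.coact_unit R.coact_unit
    unfolding quantum_bielement_def bielement_of_def forget_coactions_def Let_def
    by (auto simp: L.act_eq[symmetric] R.act_eq[symmetric] mult.commute intro!: carrier_matI)
qed

text \<open>By \<open>equivariant_eq\<close> each coefficient of either coaction is
  \<open>l * (a \<odot> 1) * l\<^sup>\<dagger>\<close>, where \<open>a\<close> is the coefficient of
  \<alpha> at the same indices.\<close>

lemma coaction_determined:
  assumes "qsystem_module tens n m i x l"
    and \<alpha>: "\<alpha> \<in> carrier_mat n n" and \<beta>: "\<beta> \<in> carrier_mat x x" and \<gamma>: "\<gamma> \<in> carrier_mat x x"
    and "\<And>a b. l * tens (coeff a b \<alpha>) (1\<^sub>m x) = coeff a b \<beta> * l"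
    and "\<And>a b. l * tens (coeff a b \<alpha>) (1\<^sub>m x) = coeff a b \<gamma> * l"
  shows "\<beta> = \<gamma>"
proof -
  interpret qsystem_module tens n m i x l by fact
  have "coeff a b \<beta> = coeff a b \<gamma>" for a b
    using equivariant_eq[of "coeff a b \<beta>" "coeff a b \<alpha>"]
      equivariant_eq[of "coeff a b \<gamma>" "coeff a b \<alpha>"] assms
    by simp
  then show ?thesis
    using op_mat_eq_iff[of \<beta> \<gamma>] \<beta> \<gamma> by auto
qed

text \<open>A bi-element records the dimension and, through adjoints, both actions. The forgotten
  coactions are recovered by \<open>coaction_determined\<close>, the left one from the action of
  \<open>Q\<close> and the right one from the action of \<open>P\<close>.\<close>

lemma inj_on_bielement_of:
  assumes Q: "qsystem H Q" and P: "qsystem G P"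
  shows "inj_on bielement_of {B. bimodule H G Q P B}"
proof (intro inj_onI, unfold mem_Collect_eq)
  fix B C
  assume B: "bimodule H G Q P B" and C: "bimodule H G Q P C" and eq: "bielement_of B = bielement_of C"
  then have same: "cell_dim (bm_cell C) = cell_dim (bm_cell B)"
    "bm_left C = bm_left B" "bm_right C = bm_right B"
    by (simp_all add: bielement_of_def)
  have UQ: "unitary_bimodule H H (q_cell Q)" and UP: "unitary_bimodule G G (q_cell P)"
    using Q P by (simp_all add: qsystem_def)
  have UB: "unitary_bimodule H G (bm_cell B)"
    "two_cell (q_cell Q \<boxtimes> bm_cell B) (bm_cell B) (bm_left B)"
    "two_cell (bm_cell B \<boxtimes> q_cell P) (bm_cell B) (bm_right B)"
    and UC: "unitary_bimodule H G (bm_cell C)"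
    "two_cell (q_cell Q \<boxtimes> bm_cell C) (bm_cell C) (bm_left C)"
    "two_cell (bm_cell C \<boxtimes> q_cell P) (bm_cell C) (bm_right C)"
    using B C by (simp_all add: bimodule_def Let_def)
  note carriers = unitary_bimodule_carrier[OF UQ] unitary_bimodule_carrier[OF UP]
    unitary_bimodule_carrier[OF UB(1)] unitary_bimodule_carrier[OF UC(1), unfolded same]
  have "left_co (bm_cell B) = left_co (bm_cell C)"
    using left_action_equivariant[OF UQ UB(1,2)] left_action_equivariant[OF UQ UC(1,2), unfolded same]
    by (intro coaction_determined[OF left_module[OF Q B] carriers(1,5,7)])
  moreover have "right_co (bm_cell B) = right_co (bm_cell C)"
    using right_action_equivariant[OF UP UB(1,3)] right_action_equivariant[OF UP UC(1,3), unfolded same]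
    by (intro coaction_determined[OF right_module[OF P B] carriers(4,6,8)])
  ultimately show "B = C"
    using same by (intro bimod.equality one_cell.equality) simp_all
qed

text \<open>On each side, commuting with the actions amounts to commuting with their adjoints. For
  the converse the coactions must be respected as well, which \<open>module_map_equivariant\<close>
  supplies.\<close>

lemma bimodule_intertwiner_iff:
  assumes Q: "qsystem H Q" and P: "qsystem G P"
    and B: "bimodule H G Q P B" and C: "bimodule H G Q P C"
  shows "bimodule_intertwiner Q P B C f \<longleftrightarrow>
    bielement_intertwiner (forget_coactions Q) (forget_coactions P) (bielement_of B) (bielement_of C) f"
proof -
  have UQ: "unitary_bimodule H H (q_cell Q)" and UP: "unitary_bimodule G G (q_cell P)"
    using Q P by (simp_all add: qsystem_def)
  have UB: "unitary_bimodule H G (bm_cell B)"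
    "two_cell (q_cell Q \<boxtimes> bm_cell B) (bm_cell B) (bm_left B)"
    "two_cell (bm_cell B \<boxtimes> q_cell P) (bm_cell B) (bm_right B)"
    and UC: "unitary_bimodule H G (bm_cell C)"
    "two_cell (q_cell Q \<boxtimes> bm_cell C) (bm_cell C) (bm_left C)"
    "two_cell (bm_cell C \<boxtimes> q_cell P) (bm_cell C) (bm_right C)"
    using B C by (simp_all add: bimodule_def Let_def)
  note left = left_module[OF Q B] left_module[OF Q C]
    and right = right_module[OF P B] right_module[OF P C]
  note carriers = unitary_bimodule_carrier[OF UQ] unitary_bimodule_carrier[OF UP]
    unitary_bimodule_carrier[OF UB(1)] unitary_bimodule_carrier[OF UC(1)]
  let ?IQ = "1\<^sub>m (cell_dim (q_cell Q))" and ?IP = "1\<^sub>m (cell_dim (q_cell P))"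
  have "two_cell (bm_cell B) (bm_cell C) f"
    if f: "f \<in> carrier_mat (cell_dim (bm_cell C)) (cell_dim (bm_cell B))"
      and "f * bm_left B = bm_left C * (?IQ \<otimes>\<^sub>m f)" "f * bm_right B = bm_right C * (f \<otimes>\<^sub>m ?IP)"
  proof -
    \<comment> \<open>The operator on the algebra is the coefficient of the coaction of
      \<open>Q\<close> at the same pair of indices.\<close>
    have "f * coeff a b (left_co (bm_cell B)) = coeff a b (left_co (bm_cell C)) * f" for a b
      by (rule module_map_equivariant[OF left f that(2), where a = "coeff a b (left_co (q_cell Q))"])
        (use carriers left_action_equivariant[OF UQ UB(1,2)]
          left_action_equivariant[OF UQ UC(1,2)] in simp_all)
    moreover have "f * coeff a b (right_co (bm_cell B)) = coeff a b (right_co (bm_cell C)) * f" for a b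
      by (rule module_map_equivariant[OF right f that(3), where a = "coeff a b (right_co (q_cell P))"])
        (use carriers right_action_equivariant[OF UP UB(1,3)]
          right_action_equivariant[OF UP UC(1,3)] in simp_all)
    ultimately show ?thesis
      using f by (simp add: two_cell_iff[OF UB(1) UC(1)])
  qed
  moreover have "f \<in> carrier_mat (cell_dim (bm_cell C)) (cell_dim (bm_cell B))"
    if "two_cell (bm_cell B) (bm_cell C) f"
    using that by (simp add: two_cell_def)
  ultimately show ?thesis
    using module_map_iff_comodule_map[OF left, of f] module_map_iff_comodule_map[OF right, of f]
    unfolding bimodule_intertwiner_def bielement_intertwiner_def bielement_of_def
      forget_coactions_def
    by auto
qed

theorem theorem1p3:
  fixes G :: "'j cqg" and H :: "'i cqg" and P :: "'j qsystem" and Q :: "'i qsystem"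
  assumes "compact_quantum_group G" and "compact_quantum_group H"
    and "qsystem G P" and "qsystem H Q"
  shows "full_subcategory_via bielement_of (QSys_hom H G Q P)
           (QBL (forget_coactions Q) (forget_coactions P))"
proof (rule full_subcategory_viaI[OF category_QBL])
  show "inj_on bielement_of (Obj (QSys_hom H G Q P))"
    using inj_on_bielement_of[OF assms(4,3)] by (simp add: QSys_hom_def)
\<comment> \<open>Objects and morphisms are settled first, with \<open>bielement_of\<close> still
  folded as in the lemmas about it; unfolding it then matches the identities, whose dimensions
  agree.\<close>
qed (use assms in \<open>auto simp: QSys_hom_def QBL_def bielement_of_bimodule bimodule_intertwiner_iff,
    auto simp: bielement_of_def\<close>)

end
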